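(* Let $\Lambda=\{(V_i,\Lambda_i,v_i)\}_{i\in I}$ be a $g$-$p$-fusion frame for $X$ with respect to $\{X_i\}_{i\in I}$ with bounds $A$ and $B$. Let $\{W_i\}_{i\in I}$ be closed subspaces of $X$ with associated projections $P_{W_i}$, and let $\Gamma_i\in\mathcal B(X,X_i)$, $i\in I$, be such that $$\Big(\sum_{i\in I}v_i^p\|(\Lambda_iP_{V_i}-\Gamma_iP_{W_i})(f)\|^p\Big)^{1/p}\le R\|f\|\quad\text{for all } f\in X,$$ where $0<R<A$. Then $\Gamma=\{(W_i,\Gamma_i,v_i)\}_{i\in I}$ is a $g$-$p$-fusion frame for $X$ with respect to $\{X_i\}_{i\in I}$ with bounds $A-R$ and $B+R$.
   Context: $X$ is a separable Banach space over $\mathbb K$ ($\mathbb R$ or $\mathbb C$), $p\in(1,\infty)$, $I\subset\mathbb N$, $\{X_i\}_{i\in I}$ is a sequence of Banach spaces over $\mathbb K$, $\mathcal B(X,X_i)$ is the space of bounded linear operators from $X$ to $X_i$, and $v_i>0$ are weights. With each closed subspace $V_i$ (or $W_i$) of $X$ there is fixed, as part of the data, a non-trivial (nonzero) linear projection $P_{V_i}$ of $X$ onto $V_i$ (respectively $P_{W_i}$ of $X$ onto $W_i$). With $\Lambda_i\in\mathcal B(X,X_i)$, the family $\Lambda=\{(V_i,\Lambda_i,v_i)\}_{i\in I}$ is a $g$-$p$-fusion frame for $X$ with respect to $\{X_i\}_{i\in I}$ with (lower and upper) bounds $A,B$, where $0<A\le B<\infty$, if $A\|f\|\le\big(\sum_{i\in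 I}v_i^p\|\Lambda_iP_{V_i}(f)\|^p\big)^{1/p}\le B\|f\|$ for all $f\in X$. *)

theory Defs
  imports "HOL-Analysis.Analysis" "HOL-Algebra.Module"
begin

text \<open>
  Banach spaces are carrier-based, so that the members of a sequence of Banach spaces may have
  different carriers and different operations. The scalar field is a subset of the complex numbers:
  \<^term>\<open>\<real> :: complex set\<close> for real spaces, \<^term>\<open>UNIV :: complex set\<close> for complex ones.
\<close>

definition scalar_field :: "complex set \<Rightarrow> complex ring" where
  "scalar_field K = \<lparr>carrier = K, monoid.mult = (*), one = 1, zero = 0, add = (+)\<rparr>"

lemma scalar_field_simps [simp]:
  "carrier (scalar_field K) = K"
  "x \<otimes>\<^bsub>scalar_field K\<^esub> y = x * y"
  "\<one>\<^bsub>scalar_field K\<^esub> = 1"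
  "\<zero>\<^bsub>scalar_field K\<^esub> = 0"
  "x \<oplus>\<^bsub>scalar_field K\<^esub> y = x + y"
  by (simp_all add: scalar_field_def)

text \<open>The ring multiplication and unit inherited from the \<^typ>\<open>('a, 'b) module\<close> record are unused.\<close>

record 'a normed_space = "(complex, 'a) module" +
  nrm :: "'a \<Rightarrow> real"

text \<open>The value 0 off the carrier only serves to make \<^locale>\<open>Metric_space\<close>, which requires
  nonnegativity and symmetry on the whole type, applicable.\<close>

definition ndist :: "'a normed_space \<Rightarrow> 'a \<Rightarrow> 'a \<Rightarrow> real" where
  "ndist X x y = (if x \<in> carrier X \<and> y \<in> carrier X then nrm X (x \<ominus>\<^bsub>X\<^esub> y) else 0)"

locale normed_vector_space = module "scalar_field K" X
  for K :: "complex set" and X :: "'a normed_space" (structure) +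
  assumes nrm_eq_zero_iff: "x \<in> carrier X \<Longrightarrow> nrm X x = 0 \<longleftrightarrow> x = \<zero>"
    and nrm_smult: "\<lbrakk>a \<in> K; x \<in> carrier X\<rbrakk> \<Longrightarrow> nrm X (a \<odot> x) = cmod a * nrm X x"
    and nrm_triangle: "\<lbrakk>x \<in> carrier X; y \<in> carrier X\<rbrakk> \<Longrightarrow> nrm X (x \<oplus> y) \<le> nrm X x + nrm X y"
    and nrm_nonneg: "x \<in> carrier X \<Longrightarrow> 0 \<le> nrm X x"

lemma (in normed_vector_space) nrm_uminus:
  assumes x: "x \<in> carrier X"
  shows "nrm X (\<ominus> x) = nrm X x"
proof -
  define m where "m = \<ominus>\<^bsub>scalar_field K\<^esub> \<one>\<^bsub>scalar_field K\<^esub>"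
  have mK: "m \<in> carrier (scalar_field K)"
    unfolding m_def by (intro R.a_inv_closed R.one_closed)
  have "m \<oplus>\<^bsub>scalar_field K\<^esub> \<one>\<^bsub>scalar_field K\<^esub> = \<zero>\<^bsub>scalar_field K\<^esub>"
    unfolding m_def by (intro R.l_neg R.one_closed)
  then have m: "m = -1"
    by (simp add: eq_neg_iff_add_eq_0)
  have "\<ominus> x = m \<odot> x"
    using smult_l_minus[OF R.one_closed x] x smult_one[OF x] unfolding m_def by metis
  then show ?thesis
    using nrm_smult[of m x] mK x m by simp
qed

lemma (in normed_vector_space) Metric_space_ndist: "Metric_space (carrier X) (ndist X)"
proof
  fix x y z
  show "0 \<le> ndist X x y"
    by (simp add: ndist_def nrm_nonneg)
  show "ndist X x y = ndist X y x"
  proof (cases "x \<in> carrier X \<and> y \<in> carrier X")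
    case True
    then have "\<ominus> (x \<ominus> y) = y \<ominus> x"
      by (simp add: a_minus_def M.minus_add M.a_comm)
    then show ?thesis
      using nrm_uminus[of "x \<ominus> y"] True by (simp add: ndist_def)
  qed (auto simp: ndist_def)
  show "ndist X x y = 0 \<longleftrightarrow> x = y" if "x \<in> carrier X" "y \<in> carrier X"
  proof -
    have "x \<ominus> y = \<zero> \<longleftrightarrow> x = y"
      using that M.minus_equality[of x "\<ominus> y"] by (auto simp: a_minus_def M.r_neg)
    then show ?thesis
      using that by (simp add: ndist_def nrm_eq_zero_iff)
  qed
  show "ndist X x z \<le> ndist X x y + ndist X y z"
    if "x \<in> carrier X" "y \<in> carrier X" "z \<in> carrier X"
  proof -
    have "x \<ominus> z = (x \<ominus> y) \<oplus> (y \<ominus> z)"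
      using that by (simp add: a_minus_def M.a_assoc M.r_neg1)
    then show ?thesis
      using nrm_triangle[of "x \<ominus> y" "y \<ominus> z"] that by (simp add: ndist_def)
  qed
qed

locale banach_space = normed_vector_space +
  assumes complete: "Metric_space.mcomplete (carrier X) (ndist X)"

definition norm_topology :: "'a normed_space \<Rightarrow> 'a topology" where
  "norm_topology X = Metric_space.mtopology (carrier X) (ndist X)"

definition closed_subspace :: "complex set \<Rightarrow> 'a normed_space \<Rightarrow> 'a set \<Rightarrow> bool" where
  "closed_subspace K X V \<longleftrightarrow> submodule V (scalar_field K) X \<and> closedin (norm_topology X) V"

definition linear_map ::
    "complex set \<Rightarrow> 'a normed_space \<Rightarrow> 'b normed_space \<Rightarrow> ('a \<Rightarrow> 'b) \<Rightarrow> bool" where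
  "linear_map K X Y T \<longleftrightarrow> T \<in> hom (add_monoid X) (add_monoid Y) \<and>
     (\<forall>a\<in>K. \<forall>x\<in>carrier X. T (a \<odot>\<^bsub>X\<^esub> x) = a \<odot>\<^bsub>Y\<^esub> T x)"

definition bounded_operators ::
    "complex set \<Rightarrow> 'a normed_space \<Rightarrow> 'b normed_space \<Rightarrow> ('a \<Rightarrow> 'b) set" where
  "bounded_operators K X Y =
     {T. linear_map K X Y T \<and> (\<exists>C. \<forall>x\<in>carrier X. nrm Y (T x) \<le> C * nrm X x)}"

text \<open>Projections are linear and idempotent; boundedness is not required.\<close>

definition nontrivial_projection ::
    "complex set \<Rightarrow> 'a normed_space \<Rightarrow> 'a set \<Rightarrow> ('a \<Rightarrow> 'a) \<Rightarrow> bool" where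
  "nontrivial_projection K X V P \<longleftrightarrow>
     linear_map K X X P \<and> P ` carrier X = V \<and> (\<forall>x\<in>carrier X. P (P x) = P x) \<and>
     (\<exists>x\<in>carrier X. P x \<noteq> \<zero>\<^bsub>X\<^esub>)"

text \<open>\<open>(\<Sum>\<^sub>i v\<^sub>i\<^sup>p a\<^sub>i\<^sup>p)\<^sup>1\<^sup>/\<^sup>p\<close> for nonnegative \<open>a\<close>, with value \<open>\<infinity>\<close> if the series diverges.\<close>

definition weighted_lp_norm ::
    "real \<Rightarrow> nat set \<Rightarrow> (nat \<Rightarrow> real) \<Rightarrow> (nat \<Rightarrow> real) \<Rightarrow> ereal" where
  "weighted_lp_norm p I v a =
     (if (\<lambda>i. v i powr p * a i powr p) summable_on I
      then ereal ((\<Sum>\<^sub>\<infinity>i\<in>I. v i powr p * a i powr p) powr (1 / p)) else \<infinity>)"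

definition g_p_fusion_frame ::
    "complex set \<Rightarrow> 'a normed_space \<Rightarrow> real \<Rightarrow> nat set \<Rightarrow> (nat \<Rightarrow> 'b normed_space) \<Rightarrow>
     (nat \<Rightarrow> 'a set) \<Rightarrow> (nat \<Rightarrow> 'a \<Rightarrow> 'a) \<Rightarrow> (nat \<Rightarrow> 'a \<Rightarrow> 'b) \<Rightarrow> (nat \<Rightarrow> real) \<Rightarrow>
     real \<Rightarrow> real \<Rightarrow> bool" where
  "g_p_fusion_frame K X p I Y V P \<Lambda> v A B \<longleftrightarrow>
     (\<forall>i\<in>I. closed_subspace K X (V i) \<and> nontrivial_projection K X (V i) (P i) \<and>
        \<Lambda> i \<in> bounded_operators K X (Y i) \<and> 0 < v i) \<and>
     0 < A \<and> A \<le> B \<and>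
     (\<forall>f\<in>carrier X.
        ereal (A * nrm X f) \<le> weighted_lp_norm p I v (\<lambda>i. nrm (Y i) (\<Lambda> i (P i f))) \<and>
        weighted_lp_norm p I v (\<lambda>i. nrm (Y i) (\<Lambda> i (P i f))) \<le> ereal (B * nrm X f))"

end

theory Submission
  imports Defs
begin

text \<open>
  The map sending \<open>f\<close> to the sequence of the vectors \<open>\<Lambda>\<^sub>i (P\<^bsub>V\<^sub>i\<^esub> f)\<close>, measured in the weighted
  \<open>\<ell>\<^sup>p\<close>-sum of the spaces \<open>Y\<^sub>i\<close>, is bounded below by \<open>A\<close> and above by \<open>B\<close>, and the hypothesis says
  that the corresponding map for \<open>\<Gamma>\<close> differs from it by at most \<open>R\<close>. A perturbation of size \<open>R\<close>
  moves both bounds by at most \<open>R\<close>: this is the triangle inequality in the \<open>\<ell>\<^sup>p\<close>-sum, used once in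
  each direction.

  The triangle inequality splits into the one of each \<open>Y\<^sub>i\<close> (\<open>nrm_le_nrm_add_diff\<close>)
  and Minkowski's inequality for nonnegative scalar sequences
  (\<open>weighted_lp_norm_triangle\<close>). Since \<open>weighted_lp_norm\<close> is \<open>\<infinity>\<close> for a divergent series, Minkowski's
  inequality also contains the convergence of the series for \<open>\<Gamma>\<close>. It is therefore derived from
  estimates of finite partial sums, which characterise the norm
  (\<open>weighted_lp_norm_le_iff\<close>) whether or not the series converges.
\<close>

lemma powr_convex_combination_le:
  fixes p u w x y :: real
  assumes p: "1 \<le> p" and u: "0 \<le> u" and w: "0 \<le> w" and uw: "u + w = 1"
    and x: "0 \<le> x" and y: "0 \<le> y"
  shows "(u * x + w * y) powr p \<le> u * x powr p + w * y powr p"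
proof -
  (* Convexity on the open half-line does not reach a vanishing argument, where the claim follows
     from homogeneity and r powr p \<le> r for r in the unit interval. *)
  have scale: "(r * z) powr p \<le> r * z powr p" if "0 \<le> r" "r \<le> 1" for r z :: real
  proof -
    have "r powr p \<le> r"
      using powr_mono'[of 1 p r] that p by simp
    then show ?thesis
      using that by (simp add: powr_mult mult_right_mono)
  qed
  consider "x = 0" | "y = 0" | "0 < x" "0 < y"
    using x y by linarith
  then show ?thesis
  proof cases
    case 1
    then show ?thesis using scale[of w y] u w uw p by simp
  next
    case 2
    then show ?thesis using scale[of u x] u w uw p by simp
  next
    case 3
    then show ?thesis
      using powr_convex[OF p] u w uw by (auto simp: convex_on_def)
  qed
qed

text \<open>
  This is convexity of \<open>z \<mapsto> z\<^sup>p\<close> applied to the points \<open>x / s\<close> and \<open>y / t\<close> with weights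
  \<open>s / (s + t)\<close> and \<open>t / (s + t)\<close>. Inserting upper bounds \<open>s\<close> and \<open>t\<close> of the two \<open>\<ell>\<^sup>p\<close>-norms and
  summing gives Minkowski's inequality at once.
\<close>

lemma powr_add_le_weighted:
  fixes p s t x y :: real
  assumes p: "1 \<le> p" and s: "0 < s" and t: "0 < t" and x: "0 \<le> x" and y: "0 \<le> y"
  shows "(x + y) powr p
    \<le> (s + t) powr p * (s / (s + t) * (x powr p / s powr p) + t / (s + t) * (y powr p / t powr p))"
proof -
  let ?z = "s / (s + t) * (x / s) + t / (s + t) * (y / t)"
  have "?z = (x + y) / (s + t)"
    using s t by (simp add: add_divide_distrib)
  then have "x + y = (s + t) * ?z"
    using s t by simp
  then have "(x + y) powr p = (s + t) powr p * ?z powr p"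
    by (metis powr_mult)
  moreover have "?z powr p \<le> s / (s + t) * (x / s) powr p + t / (s + t) * (y / t) powr p"
    using s t x y p
    by (intro powr_convex_combination_le) (auto simp: add_divide_distrib[symmetric])
  ultimately show ?thesis
    using s t x y by (simp add: powr_divide mult_left_mono)
qed

lemma weighted_lp_norm_nonneg: "0 \<le> weighted_lp_norm p I v a"
  by (simp add: weighted_lp_norm_def)

text \<open>
  Stating bounds through finite partial sums avoids the case distinction on convergence in the
  definition of the norm: the terms are nonnegative, so bounded partial sums force convergence.
\<close>

lemma weighted_lp_norm_le_iff:
  assumes p: "0 < p" and s: "0 \<le> s"
  shows "weighted_lp_norm p I v a \<le> ereal s \<longleftrightarrow>
    (\<forall>F. finite F \<and> F \<subseteq> I \<longrightarrow> (\<Sum>i\<in>F. v i powr p * a i powr p) \<le> s powr p)"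
    (is "_ \<longleftrightarrow> (\<forall>F. _ \<longrightarrow> sum ?g F \<le> _)")
proof
  assume le: "weighted_lp_norm p I v a \<le> ereal s"
  then have sm: "?g summable_on I"
    by (auto simp: weighted_lp_norm_def split: if_splits)
  with le have "infsum ?g I powr (1 / p) \<le> s"
    by (simp add: weighted_lp_norm_def)
  then have "(infsum ?g I powr (1 / p)) powr p \<le> s powr p"
    using p by (intro powr_mono2) auto
  moreover have "0 \<le> infsum ?g I"
    by (rule infsum_nonneg) simp
  ultimately have "infsum ?g I \<le> s powr p"
    using p by (simp add: powr_powr)
  then show "\<forall>F. finite F \<and> F \<subseteq> I \<longrightarrow> sum ?g F \<le> s powr p"
    using finite_sum_le_infsum[OF sm] by (fastforce intro: order_trans)
next
  assume *: "\<forall>F. finite F \<and> F \<subseteq> I \<longrightarrow> sum ?g F \<le> s powr p"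
  then have sm: "?g summable_on I"
    by (intro nonneg_bdd_above_summable_on bdd_aboveI2[where M = "s powr p"]) auto
  have "infsum ?g I \<le> s powr p"
    using * by (intro infsum_le_finite_sums[OF sm]) auto
  moreover have "0 \<le> infsum ?g I"
    by (rule infsum_nonneg) simp
  ultimately have "infsum ?g I powr (1 / p) \<le> (s powr p) powr (1 / p)"
    using p by (intro powr_mono2) auto
  then show "weighted_lp_norm p I v a \<le> ereal s"
    using sm p s by (simp add: weighted_lp_norm_def powr_powr)
qed

lemma weighted_lp_norm_triangle_bounds:
  assumes p: "1 \<le> p" and s: "0 < s" and t: "0 < t"
    and a: "\<And>i. i \<in> I \<Longrightarrow> 0 \<le> a i" and b: "\<And>i. i \<in> I \<Longrightarrow> 0 \<le> b i"
    and c: "\<And>i. i \<in> I \<Longrightarrow> 0 \<le> c i" and le: "\<And>i. i \<in> I \<Longrightarrow> c i \<le> a i + b i"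
    and as: "weighted_lp_norm p I v a \<le> ereal s" and bt: "weighted_lp_norm p I v b \<le> ereal t"
  shows "weighted_lp_norm p I v c \<le> ereal (s + t)"
proof -
  have "(\<Sum>i\<in>F. v i powr p * c i powr p) \<le> (s + t) powr p" if F: "finite F" "F \<subseteq> I" for F
  proof -
    let ?Sa = "\<Sum>i\<in>F. v i powr p * a i powr p" and ?Sb = "\<Sum>i\<in>F. v i powr p * b i powr p"
    have "c i powr p \<le> (s + t) powr p *
        (s / (s + t) * (a i powr p / s powr p) + t / (s + t) * (b i powr p / t powr p))"
      if "i \<in> F" for i
    proof -
      have "i \<in> I"
        using that F by auto
      then have "c i powr p \<le> (a i + b i) powr p"
        using p c le by (intro powr_mono2) auto
      then show ?thesis
        using powr_add_le_weighted[OF p s t a b] \<open>i \<in> I\<close> by (meson order_trans)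
    qed
    then have "(\<Sum>i\<in>F. v i powr p * c i powr p) \<le> (\<Sum>i\<in>F. v i powr p * ((s + t) powr p *
        (s / (s + t) * (a i powr p / s powr p) + t / (s + t) * (b i powr p / t powr p))))"
      by (intro sum_mono mult_left_mono) auto
    also have "\<dots> = (s + t) powr p *
        (s / (s + t) * (?Sa / s powr p) + t / (s + t) * (?Sb / t powr p))"
      by (simp add: sum_distrib_left sum_divide_distrib sum.distrib algebra_simps)
    also have "\<dots> \<le> (s + t) powr p * (s / (s + t) * 1 + t / (s + t) * 1)"
    proof -
      have "?Sa \<le> s powr p" "?Sb \<le> t powr p"
        using as bt p s t F by (simp_all add: weighted_lp_norm_le_iff)
      then show ?thesis
        using s t by (intro mult_left_mono add_mono) (auto simp: divide_le_eq_1)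
    qed
    also have "\<dots> = (s + t) powr p"
      using s t by (simp add: add_divide_distrib[symmetric])
    finally show ?thesis .
  qed
  then show ?thesis
    using p s t by (subst weighted_lp_norm_le_iff) auto
qed

text \<open>
  Strictly positive upper bounds of the norms are needed for the division by \<open>s\<close> and \<open>t\<close> in the
  convexity argument; adding \<open>e / 2\<close> to the norms provides them even when a norm is zero.
\<close>

lemma weighted_lp_norm_triangle:
  assumes p: "1 \<le> p"
    and a: "\<And>i. i \<in> I \<Longrightarrow> 0 \<le> a i" and b: "\<And>i. i \<in> I \<Longrightarrow> 0 \<le> b i"
    and c: "\<And>i. i \<in> I \<Longrightarrow> 0 \<le> c i" and le: "\<And>i. i \<in> I \<Longrightarrow> c i \<le> a i + b i"
  shows "weighted_lp_norm p I v c \<le> weighted_lp_norm p I v a + weighted_lp_norm p I v b"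
proof (cases "weighted_lp_norm p I v a = \<infinity> \<or> weighted_lp_norm p I v b = \<infinity>")
  case True
  then show ?thesis by auto
next
  case False
  then obtain x y where x: "weighted_lp_norm p I v a = ereal x" and y: "weighted_lp_norm p I v b = ereal y"
    by (metis weighted_lp_norm_def)
  then have nonneg: "0 \<le> x" "0 \<le> y"
    using weighted_lp_norm_nonneg[of p I v a] weighted_lp_norm_nonneg[of p I v b] by auto
  show ?thesis
  proof (rule ereal_le_epsilon2)
    fix e :: real assume "0 < e"
    then have "weighted_lp_norm p I v c \<le> ereal ((x + e / 2) + (y + e / 2))"
      using nonneg x y by (intro weighted_lp_norm_triangle_bounds[OF p _ _ a b c le]) auto
    then show "weighted_lp_norm p I v c \<le> weighted_lp_norm p I v a + weighted_lp_norm p I v b + ereal e"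
      using x y by (simp add: algebra_simps)
  qed
qed

lemma (in normed_vector_space) nrm_le_nrm_add_diff:
  assumes "x \<in> carrier X" "y \<in> carrier X"
  shows "nrm X x \<le> nrm X y + nrm X (x \<ominus> y)"
proof -
  have "x = y \<oplus> (x \<ominus> y)"
    using assms by (simp add: a_minus_def M.a_lcomm M.r_neg)
  then show ?thesis
    using nrm_triangle[of y "x \<ominus> y"] assms by simp
qed

lemma (in normed_vector_space) nrm_minus_commute:
  assumes "x \<in> carrier X" "y \<in> carrier X"
  shows "nrm X (x \<ominus> y) = nrm X (y \<ominus> x)"
  using Metric_space.commute[OF Metric_space_ndist, of x y] assms by (simp add: ndist_def)

lemma linear_map_closed:
  assumes "linear_map K X Y T" "x \<in> carrier X"
  shows "T x \<in> carrier Y"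
  using assms hom_in_carrier[of T "add_monoid X" "add_monoid Y" x] by (simp add: linear_map_def)

lemma bounded_operator_projection_closed:
  assumes "T \<in> bounded_operators K X Y" "nontrivial_projection K X V P" "x \<in> carrier X"
  shows "T (P x) \<in> carrier Y"
  using assms by (auto simp: bounded_operators_def nontrivial_projection_def intro: linear_map_closed)

theorem theorem4p2:
  fixes K :: "complex set" and X :: "'a normed_space" and Y :: "nat \<Rightarrow> 'b normed_space"
    and I :: "nat set" and p A B R :: real and v :: "nat \<Rightarrow> real"
    and V W :: "nat \<Rightarrow> 'a set" and PV PW :: "nat \<Rightarrow> 'a \<Rightarrow> 'a" and \<Lambda> \<Gamma> :: "nat \<Rightarrow> 'a \<Rightarrow> 'b"
  assumes "K = \<real> \<or> K = UNIV"
    and "banach_space K X" and "separable_space (norm_topology X)"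
    and "\<And>i. i \<in> I \<Longrightarrow> banach_space K (Y i)"
    and "1 < p"
    and "g_p_fusion_frame K X p I Y V PV \<Lambda> v A B"
    and "\<And>i. i \<in> I \<Longrightarrow> closed_subspace K X (W i)"
    and "\<And>i. i \<in> I \<Longrightarrow> nontrivial_projection K X (W i) (PW i)"
    and "\<And>i. i \<in> I \<Longrightarrow> \<Gamma> i \<in> bounded_operators K X (Y i)"
    and "0 < R" and "R < A"
    and "\<And>f. f \<in> carrier X \<Longrightarrow>
           weighted_lp_norm p I v (\<lambda>i. nrm (Y i) (\<Lambda> i (PV i f) \<ominus>\<^bsub>Y i\<^esub> \<Gamma> i (PW i f)))
             \<le> ereal (R * nrm X f)"
  shows "g_p_fusion_frame K X p I Y W PW \<Gamma> v (A - R) (B + R)"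
proof -
  have frame: "\<Lambda> i \<in> bounded_operators K X (Y i)" "nontrivial_projection K X (V i) (PV i)" "0 < v i"
    if "i \<in> I" for i
    using assms(6) that by (auto simp: g_p_fusion_frame_def)
  have AB: "A \<le> B"
    using assms(6) by (simp add: g_p_fusion_frame_def)
  have bounds: "ereal ((A - R) * nrm X f) \<le> weighted_lp_norm p I v (\<lambda>i. nrm (Y i) (\<Gamma> i (PW i f)))
      \<and> weighted_lp_norm p I v (\<lambda>i. nrm (Y i) (\<Gamma> i (PW i f))) \<le> ereal ((B + R) * nrm X f)"
    if f: "f \<in> carrier X" for f
  proof -
    let ?l = "\<lambda>i. nrm (Y i) (\<Lambda> i (PV i f))" and ?g = "\<lambda>i. nrm (Y i) (\<Gamma> i (PW i f))"
      and ?d = "\<lambda>i. nrm (Y i) (\<Lambda> i (PV i f) \<ominus>\<^bsub>Y i\<^esub> \<Gamma> i (PW i f))"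
    let ?N = "weighted_lp_norm p I v"
    have *: "0 \<le> ?l i" "0 \<le> ?g i" "0 \<le> ?d i" "?l i \<le> ?g i + ?d i" "?g i \<le> ?l i + ?d i"
      if i: "i \<in> I" for i
    proof -
      interpret Yi: banach_space K "Y i"
        using assms(4)[OF i] .
      have x: "\<Lambda> i (PV i f) \<in> carrier (Y i)" and y: "\<Gamma> i (PW i f) \<in> carrier (Y i)"
        using bounded_operator_projection_closed[OF frame(1,2)[OF i] f]
          bounded_operator_projection_closed[OF assms(9,8)[OF i] f] by auto
      then show "0 \<le> ?l i" "0 \<le> ?g i" "0 \<le> ?d i"
        by (auto intro!: Yi.nrm_nonneg Yi.M.minus_closed)
      show "?l i \<le> ?g i + ?d i" "?g i \<le> ?l i + ?d i"
        using Yi.nrm_le_nrm_add_diff[OF x y] Yi.nrm_le_nrm_add_diff[OF y x]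
          Yi.nrm_minus_commute[OF x y] by auto
    qed
    have lower: "ereal (A * nrm X f) \<le> ?N ?l" and upper: "?N ?l \<le> ereal (B * nrm X f)"
      using assms(6) f by (auto simp: g_p_fusion_frame_def)
    have d: "?N ?d \<le> ereal (R * nrm X f)"
      using assms(12)[OF f] .
    have "?N ?g \<le> ?N ?l + ?N ?d"
      using assms(5) * by (intro weighted_lp_norm_triangle) auto
    also have "\<dots> \<le> ereal (B * nrm X f) + ereal (R * nrm X f)"
      by (rule add_mono[OF upper d])
    finally have up: "?N ?g \<le> ereal ((B + R) * nrm X f)"
      by (simp add: distrib_right)
    have "ereal (A * nrm X f) \<le> ?N ?l"
      by (rule lower)
    also have "\<dots> \<le> ?N ?g + ?N ?d"
      using assms(5) * by (intro weighted_lp_norm_triangle) auto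
    also have "\<dots> \<le> ?N ?g + ereal (R * nrm X f)"
      by (rule add_left_mono[OF d])
    finally have "ereal ((A - R) * nrm X f) \<le> ?N ?g"
      by (cases "?N ?g") (auto simp: left_diff_distrib)
    with up show ?thesis
      by simp
  qed
  show ?thesis
    unfolding g_p_fusion_frame_def
    using assms(7-11) frame(3) AB bounds by auto
qed

end
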